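(* Let $R$ be a p.q.-Baer $*$-ring in which $2$ is invertible and let $a,b\in R$. Then $a\leq b$ (Conrad's partial order) if and only if $C(b-a)=C(b)-C(a)$.
   Context: A $*$-ring is an (associative) ring $R$ with an involution $x\mapsto x^*$, i.e. an additive anti-automorphism with $(x^* )^*=x$. A projection is an element $e\in R$ with $e=e^2=e^*$. A $*$-ring $R$ is a p.q.-Baer $*$-ring if for every $a\in R$ there is a projection $e\in R$ with $r_R(aR)=eR$, where $r_R(B)=\{x\in R : bx=0 \text{ for every } b\in B\}$. (Such a ring automatically has an identity element and is semiprime.) Conrad's partial order on $R$: $a\leq b$ if and only if $arb=ara$ for all $r\in R$; this is a partial order on every p.q.-Baer $*$-ring. The central cover $C(x)$ of $x\in R$ is the smallest central projection $h$ with $hx=x$ (central projections being ordered by $e\leq f \iff e=ef$); it is known that every element of a p.q.-Baer $*$-ring has a central cover. *)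

theory Defs
  imports Main
begin

text \<open>
  The class \<^class>\<open>ring\<close> is the class of associative rings without a postulated identity, and it
  includes the zero ring (unlike \<^class>\<open>ring_1\<close>, which demands \<open>0 \<noteq> 1\<close>).
\<close>

locale star_ring =
  fixes star :: "'a::ring \<Rightarrow> 'a"
  assumes star_add: "star (x + y) = star x + star y"
    and star_mult: "star (x * y) = star y * star x"
    and star_star: "star (star x) = x"
begin

definition projection :: "'a \<Rightarrow> bool" where
  "projection e \<longleftrightarrow> e * e = e \<and> star e = e"

definition central_projection :: "'a \<Rightarrow> bool" where
  "central_projection e \<longleftrightarrow> projection e \<and> (\<forall>r. e * r = r * e)"

text \<open>The order on projections is \<open>e \<le> f \<longleftrightarrow> e = e * f\<close>.\<close>

definition is_central_cover :: "'a \<Rightarrow> 'a \<Rightarrow> bool" where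
  "is_central_cover x h \<longleftrightarrow>
     central_projection h \<and> h * x = x \<and>
     (\<forall>k. central_projection k \<and> k * x = x \<longrightarrow> h = h * k)"

definition central_cover :: "'a \<Rightarrow> 'a" where
  "central_cover x = (THE h. is_central_cover x h)"

text \<open>Two least elements \<open>h\<close>, \<open>k\<close> satisfy \<open>h = h * k = k * h = k\<close>, so the description is unique.\<close>

lemma central_cover_eqI:
  assumes "is_central_cover x h"
  shows "central_cover x = h"
  unfolding central_cover_def
proof (rule the_equality)
  fix k assume k: "is_central_cover x k"
  have "k = k * h"
    using k assms unfolding is_central_cover_def by blast
  also have "\<dots> = h * k"
    using k unfolding is_central_cover_def central_projection_def by blast
  also have "\<dots> = h"
    by (rule sym) (use k assms in \<open>unfold is_central_cover_def, blast\<close>)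
  finally show "k = h" .
qed (rule assms)

end

definition right_annihilator :: "'a::ring set \<Rightarrow> 'a set" where
  "right_annihilator B = {x. \<forall>b\<in>B. b * x = 0}"

definition right_multiples :: "'a::ring \<Rightarrow> 'a set" where
  "right_multiples a = {a * r |r. True}"

locale pq_baer_star_ring = star_ring star
  for star :: "'a::ring \<Rightarrow> 'a" +
  assumes pq_baer:
    "\<exists>e. projection e \<and> right_annihilator (right_multiples a) = right_multiples e"

definition conrad_le :: "'a::ring \<Rightarrow> 'a \<Rightarrow> bool" where
  "conrad_le a b \<longleftrightarrow> (\<forall>r. a * r * b = a * r * a)"

definition is_identity :: "'a::ring \<Rightarrow> bool" where
  "is_identity u \<longleftrightarrow> (\<forall>x. u * x = x \<and> x * u = x)"

text \<open>
  The identity \<open>u\<close> is quantified because \<^class>\<open>ring\<close> has no constant for it; it is unique when it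
  exists, and a p.q.-Baer \<open>*\<close>-ring always has one. Here \<open>2\<close> is \<open>u + u\<close>.
\<close>

definition two_invertible :: "'a::ring itself \<Rightarrow> bool" where
  "two_invertible _ \<longleftrightarrow>
     (\<exists>u::'a. is_identity u \<and> (\<exists>v. (u + u) * v = u \<and> v * (u + u) = u))"

end

theory Submission
  imports Defs
begin

text \<open>
  The projection \<open>e\<close> generating the right annihilator of \<open>aR\<close> is central, because that annihilator is
  a two-sided ideal, and \<open>1 - e\<close> is then the central cover of \<open>a\<close>; hence \<open>aRx = 0\<close> if and only if
  \<open>C(a) x = 0\<close>. Since \<open>a \<le> b\<close> means \<open>aR(b - a) = 0\<close>, it is equivalent to \<open>C(a) C(b - a) = 0\<close>. For
  orthogonal central covers \<open>C(b) = C(a) + C(b - a)\<close>. Conversely, if \<open>C(b) - C(a)\<close> is a projection,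
  squaring it gives \<open>2 C(a) = 2 C(b) C(a)\<close>, so \<open>C(a) = C(b) C(a)\<close> and \<open>C(a) C(b - a) = 0\<close>.
\<close>

context star_ring
begin

lemma star_diff: "star (x - y) = star x - star y"
  using star_add[of "x - y" y] by (simp add: algebra_simps)

text \<open>The element \<open>u * star u\<close> is self-adjoint and equals \<open>star u\<close>,
  so \<open>star u = star (star u) = u\<close>.\<close>

lemma star_identity:
  assumes "is_identity u"
  shows "star u = u"
  using assms star_mult[of u "star u"] star_star[of u] unfolding is_identity_def by metis

lemma central_projection_complement:
  assumes u: "is_identity u" and e: "central_projection e"
  shows "central_projection (u - e)"
proof -
  have idem: "e * e = e" and sym: "star e = e" and comm: "e * r = r * e" for r
    using e unfolding central_projection_def projection_def by blast+
  have ux: "u * x = x" and xu: "x * u = x" for x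
    using u unfolding is_identity_def by blast+
  have "(u - e) * (u - e) = u - e"
    by (simp add: left_diff_distrib right_diff_distrib ux xu idem)
  moreover have "(u - e) * r = r * (u - e)" for r
    by (simp add: left_diff_distrib right_diff_distrib ux xu comm[of r])
  moreover have "star (u - e) = u - e"
    by (simp add: star_diff star_identity[OF u] sym)
  ultimately show ?thesis
    unfolding central_projection_def projection_def by blast
qed

lemma central_projection_add:
  assumes h: "central_projection h" and k: "central_projection k" and "h * k = 0"
  shows "central_projection (h + k)"
proof -
  have idem: "h * h = h" "k * k = k" and sym: "star h = h" "star k = k"
    and comm: "h * r = r * h" "k * r = r * k" for r
    using h k unfolding central_projection_def projection_def by blast+
  have "k * h = 0"
    using comm(2)[of h] assms(3) by simp
  then have "(h + k) * (h + k) = h + k"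
    using assms(3) by (simp add: distrib_left distrib_right idem)
  moreover have "(h + k) * r = r * (h + k)" for r
    by (simp add: distrib_left distrib_right comm[of r])
  moreover have "star (h + k) = h + k"
    by (simp add: star_add sym)
  ultimately show ?thesis
    unfolding central_projection_def projection_def by blast
qed

text \<open>Absorption on the left gives \<open>r * e = e * r * e\<close>. Applying
  \<open>star\<close> to this identity for \<open>star r\<close> gives the mirror image
  \<open>e * r = e * r * e\<close>, so the two products agree.\<close>

lemma projection_central_if_ideal:
  assumes e: "projection e" and ideal: "\<And>r. r * e \<in> right_multiples e"
  shows "central_projection e"
proof -
  have re: "r * e = e * r * e" for r
  proof -
    obtain s where s: "r * e = e * s"
      using ideal[of r] by (auto simp: right_multiples_def)
    have "e * r * e = e * (e * s)"
      using s by (simp add: mult.assoc)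
    also have "\<dots> = r * e"
      using e s by (simp add: projection_def mult.assoc[symmetric])
    finally show ?thesis by simp
  qed
  have "e * r = e * r * e" for r
  proof -
    have "star (star r * e) = star (e * star r * e)"
      using re[of "star r"] by simp
    then show ?thesis
      using e by (simp add: star_mult star_star projection_def mult.assoc)
  qed
  with re e show ?thesis
    by (simp add: central_projection_def)
qed

text \<open>By orthogonality \<open>h * (a + c) = a\<close>. Hence a central projection fixing the
  sum also fixes \<open>a\<close>, then \<open>c\<close>, and so lies above both \<open>h\<close>
  and \<open>k\<close>.\<close>

lemma central_cover_add:
  assumes h: "is_central_cover a h" and k: "is_central_cover c k" and hk: "h * k = 0"
  shows "is_central_cover (a + c) (h + k)"
proof -
  have ch: "h * r = r * h" for r
    using h unfolding is_central_cover_def central_projection_def by blast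
  have ha: "h * a = a" and kc: "k * c = c"
    using h k unfolding is_central_cover_def by blast+
  have kh: "k * h = 0"
    using hk ch[of k] by simp
  have hc: "h * c = 0"
    using hk kc by (metis mult.assoc mult_zero_left)
  have ka: "k * a = 0"
    using kh ha by (metis mult.assoc mult_zero_left)
  have least: "h + k = (h + k) * m"
    if m: "central_projection m" and mac: "m * (a + c) = a + c" for m
  proof -
    have cm: "m * r = r * m" for r
      using m unfolding central_projection_def by blast
    have "m * a = m * (h * (a + c))"
      using ha hc by (simp add: distrib_left)
    also have "\<dots> = h * (m * (a + c))"
      using cm[of h] by (metis mult.assoc)
    also have "\<dots> = a"
      using mac ha hc by (simp add: distrib_left)
    finally have "m * a = a" .
    moreover from this have "m * c = c"
      using mac by (simp add: distrib_left)
    ultimately have "h * m = h" "k * m = k"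
      using h k m unfolding is_central_cover_def by metis+
    then show ?thesis
      by (simp add: distrib_right)
  qed
  have "central_projection (h + k)"
    using h k hk unfolding is_central_cover_def by (intro central_projection_add) blast+
  moreover have "(h + k) * (a + c) = a + c"
    using ha kc hc ka by (simp add: algebra_simps)
  ultimately show ?thesis
    using least unfolding is_central_cover_def by blast
qed

end

context pq_baer_star_ring
begin

text \<open>Everything annihilates 0, so the projection generating that annihilator is a left
  identity; being self-adjoint, it is also a right identity.\<close>

lemma ex_identity: "\<exists>u::'a. is_identity u"
proof -
  obtain e where e: "projection e" "right_annihilator (right_multiples 0) = right_multiples e"
    using pq_baer by blast
  have ex: "e * x = x" for x
  proof -
    have "x \<in> right_multiples e"
      unfolding e(2)[symmetric] by (auto simp: right_annihilator_def right_multiples_def)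
    then show ?thesis
      using e(1) by (auto simp: right_multiples_def projection_def mult.assoc[symmetric])
  qed
  moreover have "x * e = x" for x
    using ex[of "star x"] star_mult[of e "star x"] e(1) by (simp add: star_star projection_def)
  ultimately show ?thesis
    by (auto simp: is_identity_def)
qed

text \<open>Both properties are claimed for one witness, so that uniqueness of central covers
  transfers the annihilator criterion to \<open>central_cover a\<close>.\<close>

lemma ex_central_cover_annihilator:
  "\<exists>h. is_central_cover a h \<and> (\<forall>x. h * x = 0 \<longleftrightarrow> (\<forall>r. a * r * x = 0))"
proof -
  obtain u :: 'a where u: "is_identity u"
    using ex_identity by blast
  then have ux: "u * x = x" and xu: "x * u = x" for x
    by (auto simp: is_identity_def)
  obtain e where e: "projection e" "right_annihilator (right_multiples a) = right_multiples e"
    using pq_baer by blast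
  have mult_e: "x \<in> right_multiples e \<longleftrightarrow> (\<forall>r. a * r * x = 0)" for x
    unfolding e(2)[symmetric] by (auto simp: right_annihilator_def right_multiples_def)
  \<comment> \<open>Since \<open>e\<close> is idempotent, its right multiples are the fixed points
    of left multiplication by \<open>e\<close>.\<close>
  have fix_e: "x \<in> right_multiples e \<longleftrightarrow> e * x = x" for x
    using e(1) unfolding right_multiples_def projection_def
    by (auto simp: mult.assoc[symmetric]) metis
  have e_ann: "a * r * e = 0" for r
    using mult_e[of e] fix_e[of e] e(1) by (simp add: projection_def)
  have "r * e \<in> right_multiples e" for r
    unfolding mult_e using e_ann by (metis mult.assoc)
  then have ce: "central_projection e"
    using e(1) projection_central_if_ideal by blast
  define h where "h = u - e"
  have ann: "h * x = 0 \<longleftrightarrow> (\<forall>r. a * r * x = 0)" for x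
    unfolding mult_e[symmetric] fix_e by (auto simp: h_def left_diff_distrib ux)
  have "central_projection h"
    unfolding h_def using u ce by (rule central_projection_complement)
  moreover have "h * a = a"
  proof -
    \<comment> \<open>The factor \<open>u\<close> gives the product the shape
      \<open>a * r * e\<close> required by \<open>e_ann\<close>.\<close>
    have "e * a = a * u * e"
      using ce unfolding central_projection_def xu by blast
    also have "\<dots> = 0"
      by (rule e_ann)
    finally show ?thesis
      by (simp add: h_def left_diff_distrib ux)
  qed
  moreover have "h = h * k" if k: "central_projection k" "k * a = a" for k
  proof -
    \<comment> \<open>As \<open>k\<close> is central and fixes \<open>a\<close>, it can be moved to
      \<open>a\<close> and absorbed. Thus \<open>u - k\<close> is annihilated by all
      \<open>a * r\<close>, hence by \<open>h\<close>.\<close>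
    have "a * r * k = a * r" for r
      using k unfolding central_projection_def by (metis mult.assoc)
    then have "h * (u - k) = 0"
      unfolding ann by (simp add: right_diff_distrib mult.assoc xu)
    then show ?thesis
      by (simp add: right_diff_distrib xu)
  qed
  ultimately show ?thesis
    using ann unfolding is_central_cover_def by blast
qed

lemma is_central_cover_central_cover: "is_central_cover a (central_cover a)"
  using ex_central_cover_annihilator[of a] central_cover_eqI by metis

lemma central_projection_central_cover: "central_projection (central_cover a)"
  using is_central_cover_central_cover[of a] unfolding is_central_cover_def by blast

lemma central_cover_mult_eq_0_iff:
  "central_cover a * x = 0 \<longleftrightarrow> (\<forall>r. a * r * x = 0)"
  using ex_central_cover_annihilator[of a] central_cover_eqI by metis

lemma central_cover_mult_central_cover_eq_0_iff:
  "central_cover a * central_cover x = 0 \<longleftrightarrow> central_cover a * x = 0"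
proof
  assume "central_cover a * central_cover x = 0"
  then show "central_cover a * x = 0"
    using is_central_cover_central_cover[of x] unfolding is_central_cover_def
    by (metis mult.assoc mult_zero_left)
next
  assume 0: "central_cover a * x = 0"
  have ca: "central_cover a * r = r * central_cover a" for r
    using central_projection_central_cover[of a] unfolding central_projection_def by blast
  \<comment> \<open>Moving the central factor to the front makes \<open>central_cover a * x\<close>
    appear. The annihilator criterion can then be used with \<open>x\<close> in the role of the
    covered element.\<close>
  have "x * r * central_cover a = 0" for r
    using 0 ca[of "x * r"] by (simp add: mult.assoc[symmetric])
  then have "central_cover x * central_cover a = 0"
    by (simp add: central_cover_mult_eq_0_iff)
  then show "central_cover a * central_cover x = 0"
    using ca[of "central_cover x"] by simp
qed

lemma conrad_le_iff_central_cover_orthogonal: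
  "conrad_le a b \<longleftrightarrow> central_cover a * central_cover (b - a) = 0"
proof -
  have "conrad_le a b \<longleftrightarrow> (\<forall>r. a * r * (b - a) = 0)"
    by (simp add: conrad_le_def right_diff_distrib)
  then show ?thesis
    using central_cover_mult_central_cover_eq_0_iff[of a "b - a"]
      central_cover_mult_eq_0_iff[of a "b - a"] by blast
qed

end

text \<open>Because \<open>z + z = (u + u) * z\<close>, left multiplication by the inverse
  \<open>v\<close> of \<open>u + u\<close> halves \<open>z + z\<close>.\<close>

lemma two_invertible_double_cancel:
  fixes x y :: "'a::ring"
  assumes "two_invertible TYPE('a)" and "x + x = y + y"
  shows "x = y"
proof -
  obtain u v :: 'a where u: "is_identity u" and v: "v * (u + u) = u"
    using assms(1) unfolding two_invertible_def by blast
  have ux: "u * z = z" for z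
    using u unfolding is_identity_def by blast
  have half: "v * (z + z) = z" for z
  proof -
    have "v * (z + z) = v * ((u + u) * z)"
      by (simp only: distrib_right ux)
    also have "\<dots> = z"
      by (simp only: mult.assoc[symmetric] v ux)
    finally show ?thesis .
  qed
  have "v * (x + x) = v * (y + y)"
    by (simp only: assms(2))
  then show ?thesis
    unfolding half .
qed

theorem theorem2p7:
  fixes star :: "'a::ring \<Rightarrow> 'a" and a b :: 'a
  assumes "pq_baer_star_ring star"
    and "two_invertible TYPE('a)"
  shows "conrad_le a b \<longleftrightarrow>
    star_ring.central_cover star (b - a) =
      star_ring.central_cover star b - star_ring.central_cover star a"
proof -
  interpret pq_baer_star_ring star
    by (rule assms(1))
  let ?C = central_cover
  have "?C a * ?C (b - a) = 0 \<longleftrightarrow> ?C (b - a) = ?C b - ?C a"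
  proof
    assume "?C a * ?C (b - a) = 0"
    \<comment> \<open>The sum \<open>a + (b - a)\<close> is \<open>b\<close>, so this computes the
      cover of \<open>b\<close>.\<close>
    then have "is_central_cover (a + (b - a)) (?C a + ?C (b - a))"
      by (rule central_cover_add[OF is_central_cover_central_cover is_central_cover_central_cover])
    then have "?C (a + (b - a)) = ?C a + ?C (b - a)"
      by (rule central_cover_eqI)
    then show "?C (b - a) = ?C b - ?C a"
      by simp
  next
    assume eq: "?C (b - a) = ?C b - ?C a"
    have idem: "?C x * ?C x = ?C x" and comm: "?C x * r = r * ?C x" for x r
      using central_projection_central_cover[of x]
      unfolding central_projection_def projection_def by blast+
    \<comment> \<open>By assumption the difference is itself a central cover, hence
      idempotent.\<close>
    have "?C b - ?C a = (?C b - ?C a) * (?C b - ?C a)"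
      using idem[of "b - a"] unfolding eq by (rule sym)
    also have "\<dots> = ?C b - ?C a * ?C b - (?C a * ?C b - ?C a)"
      by (simp only: left_diff_distrib right_diff_distrib idem comm[of b "?C a"])
    finally have "?C a + ?C a = ?C a * ?C b + ?C a * ?C b"
      by (simp add: algebra_simps)
    then have "?C a = ?C a * ?C b"
      by (rule two_invertible_double_cancel[OF assms(2)])
    then show "?C a * ?C (b - a) = 0"
      unfolding eq by (simp add: idem right_diff_distrib)
  qed
  then show ?thesis
    by (simp add: conrad_le_iff_central_cover_orthogonal)
qed

end
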